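(* Let $f,\tilde f\in\mathbb{Q}_p[T]$ be $p$-adic polynomials of degree $d$ with $f\neq 0$. If $\kappa(f)^2\frac{\|\tilde f-f\|}{\|f\|}<1$, then: (i) $f$ and $\tilde f$ have the same number of roots in $\mathbb{Z}_p$; (ii) for every root $\tilde\zeta\in\mathbb{Z}_p$ of $\tilde f$, $\alpha(f,\tilde\zeta)\le1/p$; in particular there is a unique root $\zeta\in\mathbb{Z}_p$ of $f$ such that for all $k\ge0$, $|N_f^k(\tilde\zeta)-\zeta|\le p^{-2^k}$; (iii) for every root $\zeta\in\mathbb{Z}_p$ of $f$, $\alpha(\tilde f,\zeta)\le1/p$; in particular there is a unique root $\tilde\zeta\in\mathbb{Z}_p$ of $\tilde f$ such that for all $k\ge0$, $|N_{\tilde f}^k(\zeta)-\tilde\zeta|\le p^{-2^k}$.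
   Context: $|\cdot|$ is the $p$-adic absolute value ($|p|=1/p$); for $f=\sum_kf_kT^k$, $\|f\|:=\max_k|f_k|$. For nonzero $f$ and $x\in\mathbb{Z}_p$, $\kappa(f,x):=\|f\|/\max\{|f(x)|,|f'(x)|\}\in(0,\infty]$ and $\kappa(f):=\sup_{z\in\mathbb{Z}_p}\kappa(f,z)$. For $f'(x)\neq0$: $\beta(f,x)=|f(x)/f'(x)|$, $\gamma(f,x)=\max_{k\ge2}|f^{(k)}(x)/(k!f'(x))|^{1/(k-1)}$, $\alpha(f,x)=\beta(f,x)\gamma(f,x)$ ($\alpha=\infty$ if $f'(x)=0$). The Newton operator is $N_f(x)=x-f(x)/f'(x)$. *)

theory Defs
  imports
    "HOL-Analysis.Analysis"
    "HOL-Computational_Algebra.Computational_Algebra"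
    "Berlekamp_Zassenhaus.Finite_Field"
begin

hide_const (open) up_ring.coeff up_ring.monom

text \<open>
  The prime \<open>p\<close> is the cardinality of a type \<open>'p\<close> of class \<open>prime_card\<close>.
  The ring of \<open>p\<close>-adic integers is the inverse limit of the rings \<open>\<int> / p ^ n\<close>: an element is
  a compatible sequence of residues, the \<open>n\<close>-th one represented in \<open>{0..<p ^ n}\<close>.
\<close>

abbreviation pint :: "'p::prime_card itself \<Rightarrow> int"
  where "pint _ \<equiv> int CARD('p)"

lemma prime_pint: "prime (pint TYPE('p::prime_card))"
  by (rule prime_card_int)

lemma pint_gt_1: "pint TYPE('p::prime_card) > 1"
  using prime_pint[where 'p = 'p] prime_gt_1_int by blast

text \<open>The case \<open>m = n\<close> below says that the \<open>n\<close>-th entry is reduced modulo \<open>p ^ n\<close>.\<close>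

typedef (overloaded) 'p padic_int =
  "{a :: nat \<Rightarrow> int. \<forall>m n. m \<le> n \<longrightarrow> a n mod pint TYPE('p::prime_card) ^ m = a m}"
  by (rule exI[of _ "\<lambda>_. 0"]) simp

setup_lifting type_definition_padic_int

lemma mod_pint_power_mod:
  "m \<le> n \<Longrightarrow> (x mod pint TYPE('p::prime_card) ^ n) mod pint TYPE('p) ^ m = x mod pint TYPE('p) ^ m"
  by (simp add: le_imp_power_dvd mod_mod_cancel)

instantiation padic_int :: (prime_card) comm_ring_1
begin

lift_definition zero_padic_int :: "'a padic_int" is "\<lambda>_. 0" by simp

lift_definition one_padic_int :: "'a padic_int" is "\<lambda>n. 1 mod pint TYPE('a) ^ n"
  by (simp add: mod_pint_power_mod)

lift_definition plus_padic_int :: "'a padic_int \<Rightarrow> 'a padic_int \<Rightarrow> 'a padic_int"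
  is "\<lambda>a b n. (a n + b n) mod pint TYPE('a) ^ n"
  by (simp add: mod_pint_power_mod) (metis mod_add_eq)

lift_definition minus_padic_int :: "'a padic_int \<Rightarrow> 'a padic_int \<Rightarrow> 'a padic_int"
  is "\<lambda>a b n. (a n - b n) mod pint TYPE('a) ^ n"
  by (simp add: mod_pint_power_mod) (metis mod_diff_eq)

lift_definition uminus_padic_int :: "'a padic_int \<Rightarrow> 'a padic_int"
  is "\<lambda>a n. (- a n) mod pint TYPE('a) ^ n"
  by (simp add: mod_pint_power_mod) (metis mod_minus_eq)

lift_definition times_padic_int :: "'a padic_int \<Rightarrow> 'a padic_int \<Rightarrow> 'a padic_int"
  is "\<lambda>a b n. (a n * b n) mod pint TYPE('a) ^ n"
  by (simp add: mod_pint_power_mod) (metis mod_mult_eq)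

instance
proof
  fix a b c :: "'a padic_int"
  show "a * b * c = a * (b * c)"
    by transfer (simp add: mod_mult_left_eq mod_mult_right_eq mult.assoc)
  show "a * b = b * a"
    by transfer (simp add: mult.commute)
  show "1 * a = a"
    by transfer (simp add: mod_mult_left_eq)
  show "a + b + c = a + (b + c)"
    by transfer (simp add: mod_add_left_eq mod_add_right_eq add.assoc)
  show "a + b = b + a"
    by transfer (simp add: add.commute)
  show "0 + a = a"
    by transfer simp
  show "- a + a = 0"
    by transfer (simp add: mod_add_left_eq)
  show "a - b = a + - b"
    by transfer (simp add: mod_add_right_eq)
  show "(a + b) * c = a * c + b * c"
    by transfer (simp add: mod_mult_left_eq mod_add_eq distrib_right)
  show "(0::'a padic_int) \<noteq> 1"
  proof transfer
    have "(1::int) mod pint TYPE('a) ^ 1 = 1"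
      using pint_gt_1[where 'p = 'a] by simp
    then show "(\<lambda>_::nat. 0::int) \<noteq> (\<lambda>n. 1 mod pint TYPE('a) ^ n)"
      by (metis zero_neq_one)
  qed
qed

end

text \<open>The valuation: the largest \<open>n\<close> with \<open>a\<close> divisible by \<open>p ^ n\<close> (for \<open>a \<noteq> 0\<close>).\<close>

definition padic_int_val :: "'p::prime_card padic_int \<Rightarrow> nat"
  where "padic_int_val a = (LEAST n. Rep_padic_int a (Suc n) \<noteq> 0)"

lemma Rep_padic_int_mod:
  "m \<le> n \<Longrightarrow> Rep_padic_int (a :: 'p::prime_card padic_int) n mod pint TYPE('p) ^ m = Rep_padic_int a m"
  using Rep_padic_int[of a] by blast

lemma Rep_padic_int_0 [simp]: "Rep_padic_int a 0 = 0"
  using Rep_padic_int_mod[of 0 0 a] by simp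

lemma padic_int_eq_0_iff: "a = 0 \<longleftrightarrow> (\<forall>n. Rep_padic_int a n = 0)"
  by transfer auto

lemma Rep_padic_int_eq_0_iff:
  assumes "a \<noteq> 0"
  shows "Rep_padic_int a n = 0 \<longleftrightarrow> n \<le> padic_int_val a"
proof -
  have mono: "Rep_padic_int a m = 0" if "Rep_padic_int a k = 0" "m \<le> k" for m k
    using Rep_padic_int_mod[of m k a] that by simp
  obtain k where k: "Rep_padic_int a k \<noteq> 0"
    using assms by (auto simp: padic_int_eq_0_iff)
  then obtain k' where "k = Suc k'"
    by (cases k) auto
  with k have k': "Rep_padic_int a (Suc k') \<noteq> 0"
    by simp
  have ex: "Rep_padic_int a (Suc (padic_int_val a)) \<noteq> 0"
    unfolding padic_int_val_def by (rule LeastI[where P = "\<lambda>n. Rep_padic_int a (Suc n) \<noteq> 0", OF k'])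
  have "Rep_padic_int a (padic_int_val a) = 0"
  proof (cases "padic_int_val a")
    case 0
    then show ?thesis by simp
  next
    case (Suc m)
    then have "m < (LEAST n. Rep_padic_int a (Suc n) \<noteq> 0)"
      by (simp add: padic_int_val_def)
    from not_less_Least[OF this] show ?thesis
      unfolding Suc by blast
  qed
  then show ?thesis
    using mono[of "padic_int_val a" n] mono[of n "Suc (padic_int_val a)"] ex
    by (cases "n \<le> padic_int_val a") (auto simp: not_le Suc_le_eq)
qed

lemma Rep_padic_int_decomp:
  assumes "(a :: 'p::prime_card padic_int) \<noteq> 0" "padic_int_val a < n"
  obtains u where "Rep_padic_int a n = pint TYPE('p) ^ padic_int_val a * u"
    and "\<not> pint TYPE('p) dvd u"
proof -
  let ?v = "padic_int_val a"
  have "Rep_padic_int a n mod pint TYPE('p) ^ ?v = 0"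
    using Rep_padic_int_mod[of ?v n a] Rep_padic_int_eq_0_iff[OF assms(1), of ?v] assms(2) by simp
  then obtain u where u: "Rep_padic_int a n = pint TYPE('p) ^ ?v * u"
    by (auto simp: mod_eq_0_iff_dvd dvd_def)
  have "\<not> pint TYPE('p) ^ Suc ?v dvd Rep_padic_int a n"
    using Rep_padic_int_mod[of "Suc ?v" n a] Rep_padic_int_eq_0_iff[OF assms(1), of "Suc ?v"] assms(2)
    by (simp add: dvd_eq_mod_eq_0)
  then have "\<not> pint TYPE('p) dvd u"
    unfolding u by (auto simp: mult.commute)
  with u show thesis by (rule that)
qed

lemma padic_int_mult_aux:
  fixes a b :: "'p::prime_card padic_int"
  assumes "a \<noteq> 0" "b \<noteq> 0"
  shows "a * b \<noteq> 0 \<and> padic_int_val (a * b) = padic_int_val a + padic_int_val b"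
proof -
  define p where "p = pint TYPE('p)"
  define i j where "i = padic_int_val a" and "j = padic_int_val b"
  define n where "n = Suc (i + j)"
  have p: "prime p" and p0: "p \<noteq> 0"
    unfolding p_def by (rule prime_pint, simp)
  have "padic_int_val a < n"
    by (simp add: n_def i_def j_def)
  then obtain u where u: "Rep_padic_int a n = p ^ i * u" "\<not> p dvd u"
    using Rep_padic_int_decomp[OF assms(1), of n] unfolding p_def i_def by metis
  have "padic_int_val b < n"
    by (simp add: n_def i_def j_def)
  then obtain v where v: "Rep_padic_int b n = p ^ j * v" "\<not> p dvd v"
    using Rep_padic_int_decomp[OF assms(2), of n] unfolding p_def j_def by metis
  have uv: "\<not> p dvd u * v"
    using p u(2) v(2) by (simp add: prime_dvd_mult_iff)
  have prod: "Rep_padic_int a n * Rep_padic_int b n = p ^ (i + j) * (u * v)"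
    by (simp add: u(1) v(1) power_add)
  have ab: "Rep_padic_int (a * b) n = (Rep_padic_int a n * Rep_padic_int b n) mod p ^ n"
    unfolding p_def by transfer simp
  have "\<not> p ^ n dvd p ^ (i + j) * (u * v)"
    using uv p0 by (simp add: n_def mult.commute)
  then have nz: "Rep_padic_int (a * b) n \<noteq> 0"
    unfolding ab prod by (simp add: dvd_eq_mod_eq_0)
  then have ab0: "a * b \<noteq> 0"
    by (auto simp: padic_int_eq_0_iff)
  have "Rep_padic_int (a * b) (i + j) = Rep_padic_int (a * b) n mod p ^ (i + j)"
    unfolding p_def by (subst Rep_padic_int_mod) (auto simp: n_def)
  also have "\<dots> = 0"
    unfolding ab prod by (simp add: n_def mod_mod_cancel)
  finally have "i + j \<le> padic_int_val (a * b)"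
    using Rep_padic_int_eq_0_iff[OF ab0] by simp
  moreover have "\<not> n \<le> padic_int_val (a * b)"
    using Rep_padic_int_eq_0_iff[OF ab0] nz by simp
  ultimately show ?thesis
    using ab0 by (simp add: n_def i_def j_def)
qed

instance padic_int :: (prime_card) idom
proof
  show "a * b \<noteq> 0" if "a \<noteq> 0" "b \<noteq> 0" for a b :: "'a padic_int"
    using padic_int_mult_aux[OF that] by simp
qed

lemma padic_int_val_mult:
  "a \<noteq> 0 \<Longrightarrow> b \<noteq> 0 \<Longrightarrow> padic_int_val (a * b) = padic_int_val a + padic_int_val b"
  using padic_int_mult_aux by blast

lemma Rep_padic_int_of_nat:
  "Rep_padic_int (of_nat k :: 'p::prime_card padic_int) n = int k mod pint TYPE('p) ^ n"
proof (induction k)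
  case 0
  then show ?case by (simp add: zero_padic_int.rep_eq)
next
  case (Suc k)
  then show ?case
    by (simp add: plus_padic_int.rep_eq one_padic_int.rep_eq mod_add_eq add.commute)
qed

instance padic_int :: (prime_card) ring_char_0
proof
  show "inj (of_nat :: nat \<Rightarrow> 'a padic_int)"
  proof (rule injI)
    fix k l assume eq: "(of_nat k :: 'a padic_int) = of_nat l"
    define n where "n = k + l"
    have "int m < pint TYPE('a) ^ m" for m
    proof -
      have "int m < 2 ^ m" by (rule of_nat_less_two_power)
      also have "2 ^ m \<le> pint TYPE('a) ^ m"
        using pint_gt_1[where 'p = 'a] by (intro power_mono) simp_all
      finally show ?thesis .
    qed
    then have "int n < pint TYPE('a) ^ n" by blast
    then have "int k < pint TYPE('a) ^ n" "int l < pint TYPE('a) ^ n"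
      unfolding n_def by linarith+
    moreover have "int k mod pint TYPE('a) ^ n = int l mod pint TYPE('a) ^ n"
      using arg_cong[OF eq, of "\<lambda>x. Rep_padic_int x n"] by (simp add: Rep_padic_int_of_nat)
    ultimately show "k = l"
      by simp
  qed
qed

instance fract :: ("{idom, ring_char_0}") field_char_0
  by standard (auto intro!: injI simp: of_nat_fract eq_fract)


type_synonym 'p padic = "'p padic_int fract"

definition padic_int_abs :: "'p::prime_card padic_int \<Rightarrow> real"
  where "padic_int_abs a = (if a = 0 then 0 else (1 / real CARD('p)) ^ padic_int_val a)"

lemma real_CARD_pos [simp]: "real CARD('p::prime_card) > 0"
  and real_CARD_gt_1: "real CARD('p::prime_card) > 1"
  using pint_gt_1[where 'p = 'p] by simp_all

lemma padic_int_abs_eq_0_iff [simp]: "padic_int_abs a = 0 \<longleftrightarrow> a = 0"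
  by (simp add: padic_int_abs_def)

lemma padic_int_abs_nonneg [simp]: "padic_int_abs a \<ge> 0"
  by (simp add: padic_int_abs_def)

lemma padic_int_abs_mult: "padic_int_abs (a * b) = padic_int_abs a * padic_int_abs b"
  by (simp add: padic_int_abs_def padic_int_val_mult power_add)

definition padic_abs :: "'p::prime_card padic \<Rightarrow> real"
  where "padic_abs x =
    (THE r. \<exists>a b. b \<noteq> 0 \<and> x = Fract a b \<and> r = padic_int_abs a / padic_int_abs b)"

lemma padic_abs_Fract:
  assumes "b \<noteq> 0"
  shows "padic_abs (Fract a b) = padic_int_abs a / padic_int_abs b"
  unfolding padic_abs_def
proof (rule the_equality)
  fix r assume "\<exists>c d. d \<noteq> 0 \<and> Fract a b = Fract c d \<and> r = padic_int_abs c / padic_int_abs d"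
  then obtain c d where d: "d \<noteq> 0" and eq: "a * d = c * b"
    and r: "r = padic_int_abs c / padic_int_abs d"
    using assms by (auto simp: eq_fract)
  have "padic_int_abs a * padic_int_abs d = padic_int_abs c * padic_int_abs b"
    using eq by (metis padic_int_abs_mult)
  then show "r = padic_int_abs a / padic_int_abs b"
    using assms d by (simp add: r frac_eq_eq)
qed (use assms in blast)

lemma padic_abs_eq_0_iff [simp]: "padic_abs x = 0 \<longleftrightarrow> x = 0"
  by (cases x) (simp add: padic_abs_Fract Zero_fract_def eq_fract)

lemma padic_abs_zero [simp]: "padic_abs 0 = 0"
  by (subst padic_abs_eq_0_iff) (rule refl)

lemma padic_abs_nonneg [simp]: "padic_abs x \<ge> 0"
  by (cases x) (simp add: padic_abs_Fract)

lemma padic_abs_mult: "padic_abs (x * y) = padic_abs x * padic_abs y"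
  by (cases x, cases y) (simp add: padic_abs_Fract padic_int_abs_mult)

lemma padic_abs_one [simp]: "padic_abs 1 = 1"
  using padic_abs_mult[of 1 1] by simp

lemma padic_int_abs_add: "padic_int_abs (a + b) \<le> max (padic_int_abs a) (padic_int_abs b)"
proof (cases "a = 0 \<or> b = 0 \<or> a + b = 0")
  case True
  then show ?thesis by (auto simp: le_max_iff_disj padic_int_abs_def)
next
  case False
  define m where "m = min (padic_int_val a) (padic_int_val b)"
  have "Rep_padic_int a m = 0" "Rep_padic_int b m = 0"
    using False by (auto simp: Rep_padic_int_eq_0_iff m_def)
  then have "Rep_padic_int (a + b) m = 0"
    by (simp add: plus_padic_int.rep_eq)
  then have "m \<le> padic_int_val (a + b)"
    using False by (simp add: Rep_padic_int_eq_0_iff)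
  then have "(1 / real CARD('a)) ^ padic_int_val (a + b) \<le> (1 / real CARD('a)) ^ m"
    using real_CARD_gt_1[where 'p = 'a] by (intro power_decreasing) auto
  then show ?thesis
    using False by (auto simp: padic_int_abs_def m_def min_def le_max_iff_disj split: if_splits)
qed

lemma padic_abs_add: "padic_abs (x + y) \<le> max (padic_abs x) (padic_abs y)"
proof (cases x, cases y)
  fix a b c d assume *: "x = Fract a b" "b \<noteq> 0" "y = Fract c d" "d \<noteq> 0"
  have pos: "padic_int_abs b > 0" "padic_int_abs d > 0"
    using * by (simp_all add: order.not_eq_order_implies_strict)
  have "padic_abs (x + y) = padic_int_abs (a * d + c * b) / (padic_int_abs b * padic_int_abs d)"
    using * by (simp add: padic_abs_Fract padic_int_abs_mult)
  also have "\<dots> \<le> max (padic_int_abs (a * d)) (padic_int_abs (c * b)) / (padic_int_abs b * padic_int_abs d)"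
    using pos by (intro divide_right_mono padic_int_abs_add) auto
  also have "\<dots> = max (padic_abs x) (padic_abs y)"
    using * pos by (simp add: padic_abs_Fract padic_int_abs_mult max_divide_distrib_right)
  finally show ?thesis .
qed

lemma padic_abs_p: "padic_abs (of_nat CARD('p) :: 'p::prime_card padic) = 1 / real CARD('p)"
proof -
  let ?p = "of_nat CARD('p) :: 'p padic_int"
  have rep: "Rep_padic_int ?p n = pint TYPE('p) mod pint TYPE('p) ^ n" for n
    using Rep_padic_int_of_nat[of "CARD('p)" n, where 'p = 'p] by simp
  have nz: "?p \<noteq> 0" by simp
  have "Rep_padic_int ?p 1 = 0" "Rep_padic_int ?p 2 \<noteq> 0"
    using pint_gt_1[where 'p = 'p] unfolding rep by (simp_all add: power2_eq_square)
  then have "padic_int_val ?p = 1"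
    unfolding Rep_padic_int_eq_0_iff[OF nz] by simp
  then show ?thesis
    using nz by (simp add: of_nat_fract padic_abs_Fract padic_int_abs_def del: of_nat_eq_0_iff)
      (simp add: padic_int_val_def one_padic_int.rep_eq)
qed

definition padic_ints :: "'p::prime_card padic set"
  where "padic_ints = range (\<lambda>a. Fract a 1)"


lemma padic_int_dvdI:
  fixes a b :: "'p::prime_card padic_int"
  assumes a: "a \<noteq> 0" and b: "b \<noteq> 0" and le: "padic_int_val b \<le> padic_int_val a"
  shows "b dvd a"
proof -
  define p j where "p = pint TYPE('p)" and "j = padic_int_val b"
  define A B where "A = Rep_padic_int a" and "B = Rep_padic_int b"
  have p: "prime p" and p0: "p > 0"
    using prime_pint[where 'p = 'p] by (auto simp: p_def)
  have A_mod: "A n mod p ^ m = A m" and B_mod: "B n mod p ^ m = B m" if "m \<le> n" for m n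
    using Rep_padic_int_mod[OF that] by (auto simp: A_def B_def p_def)
  have A_j: "p ^ j dvd A n" if "j \<le> n" for n
    using Rep_padic_int_eq_0_iff[OF a, of j] le A_mod[OF that] by (simp add: A_def j_def dvd_eq_mod_eq_0)
  have B_j: "\<exists>u. B n = p ^ j * u \<and> \<not> p dvd u" if "j < n" for n
    using Rep_padic_int_decomp[OF b, of n] that unfolding B_def p_def j_def by metis
  have unique: "r = r'"
    if r: "r \<in> {0..<p ^ n}" "p ^ (n + j) dvd B (n + j) * r - A (n + j)"
      and r': "r' \<in> {0..<p ^ n}" "p ^ (n + j) dvd B (n + j) * r' - A (n + j)" for n r r'
  proof (cases n)
    case 0
    then show ?thesis using r r' by auto
  next
    case (Suc m)
    obtain u where u: "B (n + j) = p ^ j * u" "\<not> p dvd u"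
      using B_j[of "n + j"] Suc by auto
    have "p ^ (n + j) dvd p ^ j * (u * (r - r'))"
      using dvd_diff[OF r(2) r'(2)] unfolding u(1) by (simp add: algebra_simps)
    then have "p ^ n dvd u * (r - r')"
      using p0 by (simp add: power_add mult.commute)
    moreover have "coprime (p ^ n) u"
      using p u(2) by (simp add: prime_imp_coprime coprime_power_left_iff)
    ultimately have "p ^ n dvd r - r'"
      by (simp add: coprime_dvd_mult_right_iff)
    then have "r mod p ^ n = r' mod p ^ n"
      by (simp add: mod_eq_dvd_iff)
    then show ?thesis using r(1) r'(1) by simp
  qed
  have ex: "\<exists>r. r \<in> {0..<p ^ n} \<and> p ^ (n + j) dvd B (n + j) * r - A (n + j)" for n
  proof (cases n)
    case 0
    then show ?thesis
      using A_j[of j] A_mod[of j j] B_mod[of j j] Rep_padic_int_eq_0_iff[OF b, of j]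
      by (intro exI[of _ 0]) (auto simp: B_def j_def)
  next
    case (Suc m)
    obtain u where u: "B (n + j) = p ^ j * u" "\<not> p dvd u"
      using B_j[of "n + j"] Suc by auto
    obtain a' where a': "A (n + j) = p ^ j * a'"
      using A_j[of "n + j"] by (auto simp: dvd_def)
    have "coprime u (p ^ n)"
      using p u(2) by (metis coprime_commute coprime_power_left_iff prime_imp_coprime)
    then obtain w where "[u * w = 1] (mod p ^ n)"
      using cong_solve_coprime_int by blast
    then have "[u * w * a' = 1 * a'] (mod p ^ n)"
      by (rule cong_scalar_right)
    then have "[u * (w * a' mod p ^ n) = a'] (mod p ^ n)"
      by (simp add: cong_def mod_mult_right_eq mult.assoc)
    then have "p ^ n dvd u * (w * a' mod p ^ n) - a'"
      by (simp add: cong_iff_dvd_diff)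
    then have "p ^ j * p ^ n dvd p ^ j * (u * (w * a' mod p ^ n) - a')"
      by (rule mult_dvd_mono[OF dvd_refl])
    then have "p ^ (n + j) dvd B (n + j) * (w * a' mod p ^ n) - A (n + j)"
      unfolding u(1) a' power_add by (simp add: algebra_simps)
    then show ?thesis
      using p0 by (intro exI[of _ "w * a' mod p ^ n"]) auto
  qed
  obtain c where c: "c n \<in> {0..<p ^ n}" "p ^ (n + j) dvd B (n + j) * c n - A (n + j)" for n
    using ex by metis
  have compat: "c n mod p ^ m = c m" if "m \<le> n" for m n
  proof (rule unique[of _ m])
    have "[B (m + j) * c n = B (n + j) * c n] (mod p ^ (m + j))"
      using B_mod[of "m + j" "n + j"] B_mod[of "m + j" "m + j"] that
      by (intro cong_scalar_right) (simp add: cong_def)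
    also have "[B (n + j) * c n = A (n + j)] (mod p ^ (m + j))"
      using c(2)[of n] that by (meson cong_iff_dvd_diff dvd_trans le_imp_power_dvd add_le_mono1)
    also have "[A (n + j) = A (m + j)] (mod p ^ (m + j))"
      using A_mod[of "m + j" "n + j"] A_mod[of "m + j" "m + j"] that by (simp add: cong_def)
    finally have 1: "p ^ (m + j) dvd B (m + j) * c n - A (m + j)"
      by (simp add: cong_iff_dvd_diff)
    have "p ^ j dvd B (m + j)"
      using Rep_padic_int_eq_0_iff[OF b, of j] B_mod[of j "m + j"]
      by (simp add: B_def j_def dvd_eq_mod_eq_0)
    then have "p ^ (m + j) dvd B (m + j) * (p ^ m * (c n div p ^ m))"
      by (metis add.commute dvd_mult2 mult.assoc mult_dvd_mono dvd_refl power_add)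
    with 1 have "p ^ (m + j) dvd B (m + j) * c n - A (m + j) - B (m + j) * (p ^ m * (c n div p ^ m))"
      by (rule dvd_diff)
    then show "p ^ (m + j) dvd B (m + j) * (c n mod p ^ m) - A (m + j)"
      unfolding minus_mult_div_eq_mod[symmetric] by (simp add: algebra_simps)
  qed (use c p0 in auto)
  define C where "C = (Abs_padic_int c :: 'p padic_int)"
  have C: "Rep_padic_int C = c"
    unfolding C_def using compat by (intro Abs_padic_int_inverse) (simp add: p_def)
  have "Rep_padic_int (b * C) n = A n" for n
  proof -
    have "[B n * c n = B (n + j) * c n] (mod p ^ n)"
      using B_mod[of n "n + j"] B_mod[of n n] by (intro cong_scalar_right) (simp add: cong_def)
    also have "[B (n + j) * c n = A (n + j)] (mod p ^ n)"
      using c(2)[of n] by (meson cong_iff_dvd_diff dvd_trans le_imp_power_dvd le_add1)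
    finally have "(B n * c n) mod p ^ n = A n"
      using A_mod[of n "n + j"] by (simp add: cong_def)
    then show ?thesis
      by (simp add: times_padic_int.rep_eq C B_def p_def)
  qed
  then have "b * C = a"
    unfolding A_def by (simp add: Rep_padic_int_inject[symmetric] fun_eq_iff)
  then show ?thesis by (metis dvd_triv_left)
qed

lemma padic_ints_eq_unit_ball: "padic_ints = {x :: 'p::prime_card padic. padic_abs x \<le> 1}"
proof -
  have int_le: "padic_int_abs a \<le> 1" for a :: "'p padic_int"
    using real_CARD_gt_1[where 'p = 'p] by (auto simp: padic_int_abs_def intro: power_le_one)
  have one: "padic_int_abs (1 :: 'p padic_int) = 1"
    using padic_int_abs_mult[of 1 "1 :: 'p padic_int"] by simp
  have "x \<in> padic_ints" if x: "padic_abs x \<le> 1" for x :: "'p padic"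
  proof (cases x rule: Fract_cases_nonzero)
    case (Fract a b)
    then have "padic_int_abs a \<le> padic_int_abs b"
      using x by (simp add: padic_abs_Fract divide_le_eq_1 order.not_eq_order_implies_strict)
        (metis divide_le_eq_1 padic_int_abs_eq_0_iff padic_int_abs_nonneg order_le_less not_le)
    then have "padic_int_val b \<le> padic_int_val a"
      using Fract(2,3) real_CARD_gt_1[where 'p = 'p]
        power_strict_decreasing[of "padic_int_val a" "padic_int_val b" "1 / real CARD('p)"]
      by (auto simp: padic_int_abs_def not_le[symmetric])
    then obtain c where "a = b * c"
      using padic_int_dvdI[OF Fract(3,2)] by (auto simp: dvd_def)
    then have "x = Fract c 1"
      using Fract by (simp add: eq_fract)
    then show ?thesis by (simp add: padic_ints_def)
  next
    case 0
    then show ?thesis by (auto simp: padic_ints_def Zero_fract_def)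
  qed
  then show ?thesis
    by (auto simp: padic_ints_def padic_abs_Fract one int_le)
qed


definition poly_norm :: "'p::prime_card padic poly \<Rightarrow> real"
  where "poly_norm f = Max (range (\<lambda>k. padic_abs (coeff f k)))"

lemma finite_range_padic_abs_coeff: "finite (range (\<lambda>k. padic_abs (coeff f k)))"
proof -
  have "range (\<lambda>k. padic_abs (coeff f k)) \<subseteq> insert 0 ((\<lambda>k. padic_abs (coeff f k)) ` {..degree f})"
    using le_degree by fastforce
  then show ?thesis by (rule finite_subset) simp
qed

text \<open>
  Division on \<^typ>\<open>ereal\<close> satisfies \<open>r / 0 = \<infinity>\<close> for \<open>r > 0\<close>, so for nonzero \<open>f\<close> this takes the
  value \<open>\<infinity>\<close> exactly at common zeros of \<open>f\<close> and its derivative.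
\<close>

definition local_cond :: "'p::prime_card padic poly \<Rightarrow> 'p padic \<Rightarrow> ereal"
  where "local_cond f x =
    ereal (poly_norm f) / ereal (max (padic_abs (poly f x)) (padic_abs (poly (pderiv f) x)))"

definition cond :: "'p::prime_card padic poly \<Rightarrow> ereal"
  where "cond f = (SUP z\<in>padic_ints. local_cond f z)"

definition smale_beta :: "'p::prime_card padic poly \<Rightarrow> 'p padic \<Rightarrow> real"
  where "smale_beta f x = padic_abs (poly f x / poly (pderiv f) x)"

text \<open>The set below is infinite only in its index: all terms with \<open>k > degree f\<close> are \<open>0\<close>.\<close>

definition smale_gamma :: "'p::prime_card padic poly \<Rightarrow> 'p padic \<Rightarrow> real"
  where "smale_gamma f x =
    Max ((\<lambda>k. root (k - 1) (padic_abs (poly ((pderiv ^^ k) f) x / (fact k * poly (pderiv f) x)))) ` {2..})"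

lemma higher_pderiv_eq_0:
  assumes "degree f < k"
  shows "(pderiv ^^ k) f = (0 :: 'a :: field_char_0 poly)"
proof -
  have "degree ((pderiv ^^ n) f) = degree f - n" for n
    by (induction n) (simp_all add: degree_pderiv)
  then have "degree ((pderiv ^^ (k - 1)) f) = 0"
    using assms by simp
  then have "pderiv ((pderiv ^^ (k - 1)) f) = 0"
    by (simp add: pderiv_eq_0_iff)
  then show ?thesis
    using assms by (cases k) auto
qed

lemma finite_smale_gamma_set:
  "finite ((\<lambda>k. root (k - 1) (padic_abs (poly ((pderiv ^^ k) f) x / (fact k * poly (pderiv f) x)))) ` {2..})"
  (is "finite (?g ` _)")
proof -
  have "?g k = 0" if "degree f < k" for k
    using that by (simp add: higher_pderiv_eq_0)
  then have "?g ` {2..} \<subseteq> insert 0 (?g ` {..degree f})"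
    by (metis (no_types, lifting) atMost_iff image_eqI image_subsetI insertCI not_le)
  then show ?thesis by (rule finite_subset) simp
qed

definition smale_alpha :: "'p::prime_card padic poly \<Rightarrow> 'p padic \<Rightarrow> ereal"
  where "smale_alpha f x =
    (if poly (pderiv f) x = 0 then \<infinity> else ereal (smale_beta f x * smale_gamma f x))"

text \<open>
  Since \<open>x / 0 = 0\<close> in a field type, the Newton step is meaningful only where the derivative does
  not vanish; \<open>newton_defined\<close> says that this holds at every iterate of \<open>x\<close>.
\<close>

definition newton :: "'p::prime_card padic poly \<Rightarrow> 'p padic \<Rightarrow> 'p padic"
  where "newton f x = x - poly f x / poly (pderiv f) x"

definition newton_defined :: "'p::prime_card padic poly \<Rightarrow> 'p padic \<Rightarrow> bool"
  where "newton_defined f x \<longleftrightarrow> (\<forall>k. poly (pderiv f) ((newton f ^^ k) x) \<noteq> 0)"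

definition zp_roots :: "'p::prime_card padic poly \<Rightarrow> 'p padic set"
  where "zp_roots f = {z \<in> padic_ints. poly f z = 0}"

end

theory Submission
  imports Defs
begin

text \<open>
  If \<open>g\<close> is closer to \<open>f\<close> than \<open>\<parallel>f\<parallel> / \<kappa>(f)\<^sup>2\<close>, then \<open>f\<close> and \<open>g\<close> have the same norm \<open>M\<close>, and at every
  \<open>p\<close>-adic integer root of one of them the derivatives of both have the same absolute value
  \<open>D \<ge> M / \<kappa>(f)\<close>, while the other polynomial has a value \<open>v\<close> with \<open>|v| M < D\<^sup>2\<close>. This is Hensel's
  condition: it bounds \<open>\<alpha>\<close>, and Newton's method started there converges quadratically to a root at
  distance less than \<open>D / M\<close>. Distinct roots of one polynomial are at least \<open>D / M\<close> apart, so this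
  assignment of roots is injective, and by symmetry the numbers of roots agree.
\<close>

section \<open>The \<open>p\<close>-adic absolute value\<close>

lemma padic_abs_le_0_iff [simp]: "padic_abs x \<le> 0 \<longleftrightarrow> x = 0"
  using padic_abs_nonneg[of x] padic_abs_eq_0_iff[of x] by linarith

lemma padic_abs_minus [simp]: "padic_abs (- x) = padic_abs x"
proof -
  have "padic_abs (- 1 :: 'a padic) * padic_abs (- 1 :: 'a padic) = 1"
    by (subst padic_abs_mult[symmetric]) simp
  then have "padic_abs (- 1 :: 'a padic) = 1"
    by (metis abs_of_nonneg padic_abs_nonneg real_sqrt_abs2 real_sqrt_one)
  then show ?thesis
    using padic_abs_mult[of "- 1" x] by simp
qed

lemma padic_abs_diff: "padic_abs (x - y) \<le> max (padic_abs x) (padic_abs y)"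
  using padic_abs_add[of x "- y"] by simp

lemma padic_abs_minus_commute: "padic_abs (x - y) = padic_abs (y - x)"
  using padic_abs_minus[of "x - y"] by simp

lemma padic_abs_triangle_le:
  assumes "padic_abs (x - y) \<le> r" "padic_abs (y - z) \<le> r"
  shows "padic_abs (x - z) \<le> r"
  using padic_abs_add[of "x - y" "y - z"] assms by simp

lemma padic_abs_add_le: "padic_abs x \<le> r \<Longrightarrow> padic_abs y \<le> r \<Longrightarrow> padic_abs (x + y) \<le> r"
  using padic_abs_add[of x y] by simp

lemma padic_abs_diff_le: "padic_abs x \<le> r \<Longrightarrow> padic_abs y \<le> r \<Longrightarrow> padic_abs (x - y) \<le> r"
  using padic_abs_diff[of x y] by simp

lemma padic_abs_mult_le_left: "padic_abs x \<le> 1 \<Longrightarrow> padic_abs y \<le> r \<Longrightarrow> padic_abs (x * y) \<le> r"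
  using mult_mono[of "padic_abs x" 1 "padic_abs y" r] by (simp add: padic_abs_mult)

text \<open>The isosceles principle: y = x - (x - y), and as |x - y| < |y| the ultrametric bound for
  |y| can only come from |x|. It later shows that derivatives keep their size.\<close>

lemma padic_abs_eqI:
  assumes "padic_abs (x - y) < padic_abs y"
  shows "padic_abs x = padic_abs y"
  using padic_abs_add[of "x - y" y] padic_abs_diff[of x "x - y"] assms by auto

lemma padic_abs_power: "padic_abs (x ^ n) = padic_abs x ^ n"
  by (induction n) (simp_all add: padic_abs_mult)

lemma padic_abs_divide: "padic_abs (x / y) = padic_abs x / padic_abs y"
proof (cases "y = 0")
  case False
  then have "padic_abs (x / y) * padic_abs y = padic_abs x"
    by (simp flip: padic_abs_mult)
  then show ?thesis
    using False by (simp add: field_simps)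
qed simp

lemma padic_ints_iff: "x \<in> padic_ints \<longleftrightarrow> padic_abs x \<le> 1"
  by (simp add: padic_ints_eq_unit_ball)

lemma padic_abs_of_nat_le_1: "padic_abs (of_nat n :: 'p::prime_card padic) \<le> 1"
  unfolding padic_ints_iff[symmetric] padic_ints_def of_nat_fract by blast

lemma padic_abs_Fract_1: "padic_abs (Fract a 1) = padic_int_abs a"
proof -
  have "padic_int_abs (1 :: 'a padic_int) = 1"
    using padic_int_abs_mult[of 1 "1 :: 'a padic_int"] by simp
  then show ?thesis
    by (simp add: padic_abs_Fract)
qed

text \<open>The value group is discrete: a nonzero element of absolute value below 1 has valuation
  at least 1. This converts strict inequalities into a gain of the factor 1/p.\<close>

lemma padic_abs_less_1_imp:
  fixes x :: "'p::prime_card padic"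
  assumes "padic_abs x < 1"
  shows "padic_abs x \<le> 1 / real CARD('p)"
proof -
  have "x \<in> padic_ints"
    using assms by (simp add: padic_ints_iff)
  then obtain a where x: "x = Fract a 1"
    by (auto simp: padic_ints_def)
  have ax: "padic_abs x = padic_int_abs a"
    by (simp add: x padic_abs_Fract_1)
  show ?thesis
  proof (cases "a = 0")
    case False
    then have "padic_int_val a \<noteq> 0"
      using assms by (metis ax padic_int_abs_def power_0 less_irrefl)
    then have "(1 / real CARD('p)) ^ padic_int_val a \<le> (1 / real CARD('p)) ^ 1"
      using real_CARD_gt_1[where 'p = 'p] by (intro power_decreasing) auto
    then show ?thesis
      using False by (simp add: ax padic_int_abs_def)
  qed (simp add: ax padic_int_abs_def)
qed

section \<open>Completeness\<close>

text \<open>Translates between the metric and the inverse limit: a ball around 0 is the kernel of a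
  projection to Z / p^n.\<close>

lemma padic_int_abs_le_power_iff:
  fixes a :: "'p::prime_card padic_int"
  shows "padic_int_abs a \<le> (1 / real CARD('p)) ^ n \<longleftrightarrow> Rep_padic_int a n = 0"
proof (cases "a = 0")
  case True
  then show ?thesis
    by (simp add: zero_padic_int.rep_eq padic_int_abs_def)
next
  case False
  have "(1 / real CARD('p)) ^ m \<le> (1 / real CARD('p)) ^ n \<longleftrightarrow> n \<le> m" for m
    using real_CARD_gt_1[where 'p = 'p] by (intro power_decreasing_iff) auto
  then show ?thesis
    using False by (simp add: padic_int_abs_def Rep_padic_int_eq_0_iff)
qed

lemma Rep_padic_int_diff_eq_0_iff:
  "Rep_padic_int (a - b) n = 0 \<longleftrightarrow> Rep_padic_int a n = Rep_padic_int b n"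
proof -
  have "Rep_padic_int (a - b) n = 0 \<longleftrightarrow>
      pint TYPE('a) ^ n dvd Rep_padic_int a n - Rep_padic_int b n"
    unfolding minus_padic_int.rep_eq dvd_eq_mod_eq_0 ..
  also have "\<dots> \<longleftrightarrow> Rep_padic_int a n mod pint TYPE('a) ^ n = Rep_padic_int b n mod pint TYPE('a) ^ n"
    by (rule mod_eq_dvd_iff[symmetric])
  also have "\<dots> \<longleftrightarrow> Rep_padic_int a n = Rep_padic_int b n"
    unfolding Rep_padic_int_mod[OF order_refl] ..
  finally show ?thesis .
qed

text \<open>The Cauchy rate says precisely that the residues of \<open>x n\<close> and
  \<open>x m\<close> modulo p^m agree, so the diagonal of residues is a compatible sequence and
  defines the limit.\<close>

lemma padic_ints_complete:
  fixes x :: "nat \<Rightarrow> 'p::prime_card padic"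
  assumes x: "\<And>n. x n \<in> padic_ints"
    and cauchy: "\<And>m n. m \<le> n \<Longrightarrow> padic_abs (x n - x m) \<le> (1 / real CARD('p)) ^ m"
  obtains L where "L \<in> padic_ints" "\<And>n. padic_abs (x n - L) \<le> (1 / real CARD('p)) ^ n"
proof -
  have "\<exists>a. x n = Fract a 1" for n
    using x[of n] by (auto simp: padic_ints_def)
  then obtain a where a: "\<And>n. x n = Fract (a n) 1"
    by metis
  have abs_iff: "padic_abs (Fract b 1 - Fract c 1) \<le> (1 / real CARD('p)) ^ n \<longleftrightarrow>
      Rep_padic_int b n = Rep_padic_int c n" for b c :: "'p padic_int" and n
    by (simp add: padic_abs_Fract_1 padic_int_abs_le_power_iff Rep_padic_int_diff_eq_0_iff)
  define c where "c n = Rep_padic_int (a n) n" for n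
  have "c n mod pint TYPE('p) ^ m = c m" if "m \<le> n" for m n
    using cauchy[OF that] Rep_padic_int_mod[OF that, of "a n"] unfolding a abs_iff c_def by simp
  then have "Rep_padic_int (Abs_padic_int c :: 'p padic_int) = c"
    by (intro Abs_padic_int_inverse) simp
  then have "padic_abs (x n - Fract (Abs_padic_int c) 1) \<le> (1 / real CARD('p)) ^ n" for n
    unfolding a abs_iff by (simp add: c_def)
  then show thesis
    by (intro that[of "Fract (Abs_padic_int c) 1"]) (auto simp: padic_ints_def)
qed

section \<open>The Gauss norm\<close>

lemma padic_abs_coeff_le: "padic_abs (coeff f k) \<le> poly_norm f"
  unfolding poly_norm_def by (rule Max_ge[OF finite_range_padic_abs_coeff]) simp

lemma poly_norm_attained: obtains k where "poly_norm f = padic_abs (coeff f k)"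
  using Max_in[OF finite_range_padic_abs_coeff[of f]] unfolding poly_norm_def by blast

lemma poly_norm_le_iff: "poly_norm f \<le> C \<longleftrightarrow> (\<forall>k. padic_abs (coeff f k) \<le> C)"
  by (metis order_trans padic_abs_coeff_le poly_norm_attained)

lemma poly_norm_nonneg [simp]: "0 \<le> poly_norm f"
  using padic_abs_coeff_le[of f 0] padic_abs_nonneg order_trans by blast

lemma poly_norm_eq_0_iff [simp]: "poly_norm f = 0 \<longleftrightarrow> f = 0"
proof
  assume "poly_norm f = 0"
  then have "coeff f k = 0" for k
    using padic_abs_coeff_le[of f k] by simp
  then show "f = 0"
    by (simp add: poly_eq_iff)
qed (simp add: poly_norm_def)

lemma poly_norm_minus_commute: "poly_norm (f - g) = poly_norm (g - f)"
  unfolding poly_norm_def coeff_diff by (subst padic_abs_minus_commute) (rule refl)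

lemma poly_norm_add_le: "poly_norm f \<le> r \<Longrightarrow> poly_norm g \<le> r \<Longrightarrow> poly_norm (f + g) \<le> r"
  by (simp add: poly_norm_le_iff padic_abs_add_le)

lemma poly_norm_eqI:
  assumes "poly_norm (g - f) < poly_norm f"
  shows "poly_norm g = poly_norm f"
proof (rule antisym)
  show "poly_norm g \<le> poly_norm f"
    using poly_norm_add_le[of "g - f" "poly_norm f" f] assms by simp
  show "poly_norm f \<le> poly_norm g"
    using poly_norm_add_le[of "f - g" "max (poly_norm (g - f)) (poly_norm g)" g] assms
    by (simp add: poly_norm_minus_commute[of f g])
qed

text \<open>The bound \<open>C\<close> stays fixed during the induction on \<open>f\<close>, while
  the norm of the tail may shrink.\<close>

lemma padic_abs_poly_le:
  assumes "poly_norm f \<le> C" "padic_abs x \<le> 1"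
  shows "padic_abs (poly f x) \<le> C"
proof -
  have "0 \<le> C"
    using assms(1) poly_norm_nonneg[of f] by linarith
  with assms show ?thesis
    unfolding poly_norm_le_iff
  proof (induction f)
    case (pCons a q)
    have "padic_abs a \<le> C" "\<forall>k. padic_abs (coeff q k) \<le> C"
      using pCons.prems(1) by (metis coeff_pCons_0, metis coeff_pCons_Suc)
    then show ?case
      using pCons by (simp add: padic_abs_add_le padic_abs_mult_le_left)
  qed simp
qed

lemma poly_norm_pderiv_le: "poly_norm (pderiv f) \<le> poly_norm f"
  unfolding poly_norm_le_iff coeff_pderiv
  by (intro allI padic_abs_mult_le_left padic_abs_of_nat_le_1 padic_abs_coeff_le)

lemma padic_abs_pderiv_le: "padic_abs x \<le> 1 \<Longrightarrow> padic_abs (poly (pderiv f) x) \<le> poly_norm f"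
  by (intro padic_abs_poly_le poly_norm_pderiv_le)

section \<open>Taylor coefficients and Lipschitz estimates\<close>

lemma padic_abs_taylor_coeff_le:
  assumes "padic_abs x \<le> 1"
  shows "padic_abs (poly ((pderiv ^^ k) f) x / fact k) \<le> poly_norm f"
proof -
  \<comment> \<open>Dividing by k! could enlarge a p-adic value. It does not here, because the
    coefficients of f^(k) / k! are binomial coefficients times coefficients of f.\<close>
  define h where "h = Polynomial.smult (1 / fact k) ((pderiv ^^ k) f)"
  have "coeff h n = of_nat ((n + k) choose k) * coeff f (n + k)" for n
  proof -
    have "(fact (n + k) :: 'a padic) = fact n * pochhammer (of_nat (Suc n)) k"
      unfolding pochhammer_fact pochhammer_product' of_nat_Suc ..
    then have "pochhammer (of_nat (Suc n)) k = (fact k * of_nat ((n + k) choose k) :: 'a padic)"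
      by (subst binomial_fact) simp_all
    then show ?thesis
      by (simp add: h_def coeff_higher_pderiv)
  qed
  then have "poly_norm h \<le> poly_norm f"
    unfolding poly_norm_le_iff
    by (metis padic_abs_mult_le_left padic_abs_of_nat_le_1 padic_abs_coeff_le)
  then have "padic_abs (poly h x) \<le> poly_norm f"
    using assms by (rule padic_abs_poly_le)
  then show ?thesis
    by (simp add: h_def)
qed

text \<open>Along Horner's scheme the remainder is built without any division, so it inherits the
  Gauss norm bound.\<close>

lemma poly_taylor_2:
  assumes "padic_abs x \<le> 1" "padic_abs h \<le> 1"
  obtains r where "poly f (x + h) = poly f x + h * poly (pderiv f) x + h\<^sup>2 * r"
    and "padic_abs r \<le> poly_norm f"
proof -
  have "\<exists>r. poly f (x + h) = poly f x + h * poly (pderiv f) x + h\<^sup>2 * r \<and> padic_abs r \<le> C"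
    if "poly_norm f \<le> C" "0 \<le> C" for C
    using that
  proof (induction f)
    case 0
    then show ?case by (intro exI[of _ 0]) simp
  next
    case (pCons a q)
    have q: "poly_norm q \<le> C"
      using pCons.prems(1) unfolding poly_norm_le_iff by (metis coeff_pCons_Suc)
    then obtain r where r: "poly q (x + h) = poly q x + h * poly (pderiv q) x + h\<^sup>2 * r"
      "padic_abs r \<le> C"
      using pCons by blast
    have "padic_abs (poly (pderiv q) x) \<le> C"
      using padic_abs_pderiv_le[OF assms(1), of q] q by simp
    \<comment> \<open>The new remainder collects the h^2 terms of (x + h) (q(x) + h q'(x) + h^2 r);
      the linear terms form q(x) + x q'(x), the derivative of T q at x.\<close>
    then have "padic_abs (x * r + poly (pderiv q) x + h * r) \<le> C"
      using assms r(2) by (simp add: padic_abs_add_le padic_abs_mult_le_left)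
    moreover have "poly (pCons a q) (x + h) =
        a + (x + h) * (poly q x + h * poly (pderiv q) x + h\<^sup>2 * r)"
      by (simp add: r(1))
    then have "poly (pCons a q) (x + h) = poly (pCons a q) x +
        h * poly (pderiv (pCons a q)) x + h\<^sup>2 * (x * r + poly (pderiv q) x + h * r)"
      by (simp add: pderiv_pCons algebra_simps power2_eq_square)
    ultimately show ?case by blast
  qed
  then show thesis
    using that by (meson order_refl poly_norm_nonneg)
qed

text \<open>Taking the factor x - y out of the Taylor expansion leaves a cofactor bounded by the
  Gauss norm.\<close>

lemma poly_lipschitz:
  assumes "padic_abs x \<le> 1" "padic_abs y \<le> 1"
  shows "padic_abs (poly f x - poly f y) \<le> poly_norm f * padic_abs (x - y)"
proof -
  have h: "padic_abs (x - y) \<le> 1"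
    using assms by (intro padic_abs_diff_le)
  obtain r where r: "poly f (y + (x - y)) =
      poly f y + (x - y) * poly (pderiv f) y + (x - y)\<^sup>2 * r" "padic_abs r \<le> poly_norm f"
    using poly_taylor_2[OF assms(2) h] by blast
  have "poly f x - poly f y = (x - y) * (poly (pderiv f) y + (x - y) * r)"
    using r(1) by (simp add: algebra_simps power2_eq_square)
  then have "padic_abs (poly f x - poly f y) =
      padic_abs (x - y) * padic_abs (poly (pderiv f) y + (x - y) * r)"
    by (simp only: padic_abs_mult)
  also have "\<dots> \<le> padic_abs (x - y) * poly_norm f"
    using r(2) h assms
    by (intro mult_left_mono padic_abs_add_le padic_abs_mult_le_left padic_abs_pderiv_le) simp_all
  finally show ?thesis
    by (simp only: mult.commute)
qed

lemma pderiv_lipschitz: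
  assumes "padic_abs x \<le> 1" "padic_abs y \<le> 1"
  shows "padic_abs (poly (pderiv f) x - poly (pderiv f) y) \<le> poly_norm f * padic_abs (x - y)"
  using poly_lipschitz[OF assms, of "pderiv f"]
    mult_right_mono[OF poly_norm_pderiv_le padic_abs_nonneg, of f "x - y"] by linarith

section \<open>Quadratic convergence of Newton's method\<close>

text \<open>Hensel's condition |f(x)| < |f'(x)|^2 for an \<open>f\<close> that is not normalised:
  the factor \<open>poly_norm f\<close> makes both sides scale alike when \<open>f\<close> is
  multiplied by a constant.\<close>

definition hensel :: "'p::prime_card padic poly \<Rightarrow> 'p padic \<Rightarrow> bool"
  where "hensel f x \<longleftrightarrow> x \<in> padic_ints \<and>
    padic_abs (poly f x) * poly_norm f < padic_abs (poly (pderiv f) x) ^ 2"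

lemma hensel_pderiv_nonzero: "hensel f x \<Longrightarrow> poly (pderiv f) x \<noteq> 0"
  using mult_nonneg_nonneg[OF padic_abs_nonneg poly_norm_nonneg, of "poly f x" f]
  by (force simp: hensel_def)

lemma hensel_gap:
  fixes x :: "'p::prime_card padic"
  assumes "hensel f x"
  shows "padic_abs (poly f x) * poly_norm f \<le>
    padic_abs (poly (pderiv f) x) ^ 2 / real CARD('p)"
proof -
  define D where "D = padic_abs (poly (pderiv f) x)"
  have D: "D > 0"
    using hensel_pderiv_nonzero[OF assms] by (simp add: D_def order.not_eq_order_implies_strict)
  obtain k where k: "poly_norm f = padic_abs (coeff f k)"
    by (rule poly_norm_attained)
  \<comment> \<open>The norm is attained by a coefficient, so the quotient of the two sides of
    Hensel's condition is the absolute value of a field element; being below 1, it is at most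
    1/p.\<close>
  define q where "q = poly f x * coeff f k / poly (pderiv f) x ^ 2"
  have q: "padic_abs q = padic_abs (poly f x) * poly_norm f / D ^ 2"
    by (simp add: q_def k D_def padic_abs_divide padic_abs_mult padic_abs_power)
  have "padic_abs q < 1"
    using assms D by (simp add: q hensel_def D_def[symmetric])
  from padic_abs_less_1_imp[OF this] show ?thesis
    using D by (simp add: q D_def[symmetric] field_simps)
qed

text \<open>With D = |f'(x)| and M the norm of f, gamma is at most M / D, hence alpha is at most
  |f(x)| M / D^2, which \<open>hensel_gap\<close> bounds by 1/p.\<close>

lemma smale_alpha_le:
  fixes x :: "'p::prime_card padic"
  assumes "hensel f x"
  shows "smale_alpha f x \<le> ereal (1 / real CARD('p))"
proof -
  define D M where "D = padic_abs (poly (pderiv f) x)" and "M = poly_norm f"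
  have nz: "poly (pderiv f) x \<noteq> 0"
    by (rule hensel_pderiv_nonzero[OF assms])
  then have D: "D > 0"
    by (simp add: D_def order.not_eq_order_implies_strict)
  have x: "padic_abs x \<le> 1"
    using assms by (simp add: hensel_def padic_ints_iff)
  have DM: "1 \<le> M / D"
    using padic_abs_pderiv_le[OF x, of f] D by (simp add: D_def M_def)
  have "root (k - 1) (padic_abs (poly ((pderiv ^^ k) f) x / (fact k * poly (pderiv f) x))) \<le> M / D"
    if "2 \<le> k" for k
  proof -
    have "padic_abs (poly ((pderiv ^^ k) f) x / (fact k * poly (pderiv f) x)) =
        padic_abs (poly ((pderiv ^^ k) f) x / fact k) / D"
      by (simp add: D_def flip: padic_abs_divide)
    also have "\<dots> \<le> M / D"
      using padic_abs_taylor_coeff_le[OF x, of k f] D by (simp add: M_def divide_right_mono)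
    \<comment> \<open>Since M / D \<ge> 1, raising it to the power k - 1 only enlarges it; this
      absorbs the root in gamma.\<close>
    also have "\<dots> \<le> (M / D) ^ (k - 1)"
      using DM that by (intro self_le_power) auto
    finally have "root (k - 1) (padic_abs (poly ((pderiv ^^ k) f) x / (fact k * poly (pderiv f) x)))
        \<le> root (k - 1) ((M / D) ^ (k - 1))"
      using that by (intro real_root_le_mono) auto
    also have "\<dots> = M / D"
      using DM that by (intro real_root_power_cancel) auto
    finally show ?thesis .
  qed
  then have "smale_gamma f x \<le> M / D"
    unfolding smale_gamma_def by (intro Max.boundedI finite_smale_gamma_set) auto
  moreover have "smale_beta f x = padic_abs (poly f x) / D"
    by (simp add: smale_beta_def D_def padic_abs_divide)
  ultimately have "smale_beta f x * smale_gamma f x \<le> padic_abs (poly f x) / D * (M / D)"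
    using D by (simp only:) (intro mult_left_mono, simp_all)
  also have "\<dots> = padic_abs (poly f x) * M / D ^ 2"
    by (simp add: power2_eq_square)
  also have "\<dots> \<le> 1 / real CARD('p)"
    using hensel_gap[OF assms] D by (simp add: D_def[symmetric] M_def[symmetric] field_simps)
  finally show ?thesis
    using nz by (simp add: smale_alpha_def)
qed

text \<open>The Newton correction h cancels the constant and linear Taylor terms, leaving f(x + h) =
  h^2 r. So the factor \<open>q\<close> is squared, while \<open>D\<close> stays the same and the
  step can be repeated.\<close>

lemma newton_step:
  fixes x :: "'p::prime_card padic"
  assumes x: "x \<in> padic_ints" and D: "padic_abs (poly (pderiv f) x) = D" "D > 0"
    and q: "q < 1" and le: "padic_abs (poly f x) * poly_norm f \<le> q * D ^ 2"
  shows "newton f x \<in> padic_ints"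
    and "padic_abs (poly (pderiv f) (newton f x)) = D"
    and "padic_abs (poly f (newton f x)) * poly_norm f \<le> q ^ 2 * D ^ 2"
    and "padic_abs (newton f x - x) * poly_norm f \<le> q * D"
proof -
  define M where "M = poly_norm f"
  define h where "h = - (poly f x / poly (pderiv f) x)"
  have x1: "padic_abs x \<le> 1"
    using x by (simp add: padic_ints_iff)
  have nz: "poly (pderiv f) x \<noteq> 0"
    using D by auto
  have newton: "newton f x = x + h"
    by (simp add: newton_def h_def)
  have DM: "D \<le> M"
    using padic_abs_pderiv_le[OF x1, of f] D by (simp add: M_def)
  have ah: "padic_abs h = padic_abs (poly f x) / D"
    by (simp add: h_def padic_abs_divide D)
  have hM: "padic_abs h * M \<le> q * D"
  proof -
    have "padic_abs h * M = padic_abs (poly f x) * poly_norm f / D"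
      by (simp add: ah M_def)
    also have "\<dots> \<le> q * D ^ 2 / D"
      using le D(2) by (intro divide_right_mono) auto
    finally show ?thesis
      using D(2) by (simp add: power2_eq_square)
  qed
  then show "padic_abs (newton f x - x) * poly_norm f \<le> q * D"
    by (simp add: newton M_def)
  \<comment> \<open>This is used twice: with D \<le> M it puts h into the unit ball, and by the
    Lipschitz bound it makes the derivative change by less than D.\<close>
  have hM': "padic_abs h * M < D"
    using hM mult_strict_right_mono[OF q D(2)] by simp
  then have "padic_abs h * M < 1 * M"
    using DM by simp
  then have h1: "padic_abs h \<le> 1"
    using D DM mult_less_cancel_right_pos[of M "padic_abs h" 1] by simp
  show xh: "newton f x \<in> padic_ints"
    using x1 h1 by (simp add: newton padic_ints_iff padic_abs_add_le)
  have "padic_abs (poly (pderiv f) (x + h) - poly (pderiv f) x) \<le> M * padic_abs h"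
    using pderiv_lipschitz[of "x + h" x f] x1 xh by (simp add: M_def newton padic_ints_iff)
  then show "padic_abs (poly (pderiv f) (newton f x)) = D"
    using hM' D(1) padic_abs_eqI[of "poly (pderiv f) (x + h)" "poly (pderiv f) x"]
    by (simp add: newton mult.commute[of M])
  obtain r where r: "poly f (x + h) = poly f x + h * poly (pderiv f) x + h\<^sup>2 * r"
    "padic_abs r \<le> M"
    unfolding M_def by (rule poly_taylor_2[OF x1 h1])
  have "h * poly (pderiv f) x = - poly f x"
    using nz by (simp add: h_def)
  then have "poly f (x + h) = h\<^sup>2 * r"
    unfolding r(1) by simp
  then have "padic_abs (poly f (x + h)) * M = padic_abs h ^ 2 * padic_abs r * M"
    by (simp add: padic_abs_mult padic_abs_power)
  also have "\<dots> \<le> padic_abs h ^ 2 * M * M"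
    using r(2) D DM by (intro mult_right_mono mult_left_mono) auto
  also have "\<dots> = (padic_abs h * M) ^ 2"
    by (simp add: power2_eq_square)
  also have "\<dots> \<le> (q * D) ^ 2"
    using hM D DM by (intro power_mono) auto
  finally show "padic_abs (poly f (newton f x)) * poly_norm f \<le> q ^ 2 * D ^ 2"
    by (simp add: newton M_def power_mult_distrib)
qed

text \<open>\<open>hensel_gap\<close> starts the induction with the factor 1/p, and each
  \<open>newton_step\<close> squares it, which produces the exponent 2^k.\<close>

lemma newton_iterates:
  fixes x :: "'p::prime_card padic"
  assumes "hensel f x"
  defines "D \<equiv> padic_abs (poly (pderiv f) x)"
  shows "(newton f ^^ k) x \<in> padic_ints"
    and "padic_abs (poly (pderiv f) ((newton f ^^ k) x)) = D"
    and "padic_abs (poly f ((newton f ^^ k) x)) * poly_norm f \<le> (1 / real CARD('p)) ^ (2 ^ k) * D ^ 2"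
    and "padic_abs ((newton f ^^ Suc k) x - (newton f ^^ k) x) * poly_norm f
      \<le> (1 / real CARD('p)) ^ (2 ^ k) * D"
proof -
  define q where "q = 1 / real CARD('p)"
  have q: "0 < q" "q < 1"
    using real_CARD_gt_1[where 'p = 'p] by (auto simp: q_def)
  have D: "D > 0"
    using hensel_pderiv_nonzero[OF assms(1)] by (simp add: D_def order.not_eq_order_implies_strict)
  have qk: "q ^ (2 ^ k) < 1" for k :: nat
    using power_decreasing[of 1 "2 ^ k" q] q by simp
  let ?x = "\<lambda>k. (newton f ^^ k) x"
  have inv: "?x k \<in> padic_ints \<and> padic_abs (poly (pderiv f) (?x k)) = D \<and>
    padic_abs (poly f (?x k)) * poly_norm f \<le> q ^ (2 ^ k) * D ^ 2" for k
  proof (induction k)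
    case 0
    then show ?case
      using hensel_gap[OF assms(1)] assms(1) by (simp add: hensel_def D_def q_def)
  next
    case (Suc k)
    then show ?case
      using newton_step(1-3)[of "?x k" f D "q ^ (2 ^ k)"] D qk[of k]
      by (simp add: power_mult[symmetric] mult.commute)
  qed
  then show "?x k \<in> padic_ints" "padic_abs (poly (pderiv f) (?x k)) = D"
    "padic_abs (poly f (?x k)) * poly_norm f \<le> (1 / real CARD('p)) ^ (2 ^ k) * D ^ 2"
    unfolding q_def by blast+
  show "padic_abs (?x (Suc k) - ?x k) * poly_norm f \<le> (1 / real CARD('p)) ^ (2 ^ k) * D"
    using newton_step(4)[of "?x k" f D "q ^ (2 ^ k)"] inv[of k] D qk[of k] by (simp add: q_def)
qed

lemma newton_converges:
  fixes x :: "'p::prime_card padic"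
  assumes "hensel f x"
  obtains z where "z \<in> zp_roots f"
    and "\<And>k. padic_abs ((newton f ^^ k) x - z) * poly_norm f
      \<le> (1 / real CARD('p)) ^ (2 ^ k) * padic_abs (poly (pderiv f) x)"
proof -
  define D M q where "D = padic_abs (poly (pderiv f) x)" and "M = poly_norm f"
    and "q = 1 / real CARD('p)"
  define X where "X k = (newton f ^^ k) x" for k
  note it = newton_iterates[OF assms, folded X_def D_def M_def q_def]
  have q: "0 < q" "q < 1"
    using real_CARD_gt_1[where 'p = 'p] by (auto simp: q_def)
  have D: "D > 0"
    using hensel_pderiv_nonzero[OF assms] by (simp add: D_def order.not_eq_order_implies_strict)
  have DM: "D \<le> M"
    using padic_abs_pderiv_le[of x f] assms by (simp add: D_def M_def hensel_def padic_ints_iff)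
  then have M: "M > 0" using D by simp
  have X1: "padic_abs (X k) \<le> 1" for k
    using it(1) by (simp add: padic_ints_iff)
  \<comment> \<open>By the ultrametric inequality the distance is governed by the largest step; the
    bounds decrease, so the one for index m serves for all later steps.\<close>
  have close: "padic_abs (X n - X m) \<le> q ^ (2 ^ m) * D / M" if "m \<le> n" for m n
    using that
  proof (induction n rule: dec_induct)
    case base
    then show ?case using q D M by simp
  next
    case (step n)
    have "q ^ (2 ^ n) \<le> q ^ (2 ^ m)"
      using q step.hyps by (intro power_decreasing power_increasing) auto
    then have "q ^ (2 ^ n) * D \<le> q ^ (2 ^ m) * D"
      using D by simp
    then have "padic_abs (X (Suc n) - X n) \<le> q ^ (2 ^ m) * D / M"
      using it(4)[of n] M by (simp add: pos_le_divide_eq)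
    then show ?case
      using step.IH by (rule padic_abs_triangle_le)
  qed
  \<comment> \<open>The slower rate q^m is the form that \<open>padic_ints_complete\<close> asks
    for; it follows from m \<le> 2^m and D \<le> M.\<close>
  have "padic_abs (X n - X m) \<le> q ^ m" if "m \<le> n" for m n
  proof -
    have "q ^ (2 ^ m) * (D / M) \<le> q ^ m * 1"
      using q D DM M by (intro mult_mono power_decreasing) (auto simp: less_imp_le[OF less_exp])
    then show ?thesis
      using close[OF that] by simp
  qed
  then obtain z where z: "z \<in> padic_ints" "\<And>n. padic_abs (X n - z) \<le> q ^ n"
    using padic_ints_complete[of X] it(1) unfolding q_def by blast
  have z1: "padic_abs z \<le> 1"
    using z by (simp add: padic_ints_iff)
  have lim: "(\<lambda>n. q ^ n) \<longlonglongrightarrow> 0"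
    using q by (intro LIMSEQ_realpow_zero) auto
  \<comment> \<open>Both |f(X n)|, by the iteration, and its Lipschitz error against f(z) are at
    most q^n M.\<close>
  have "padic_abs (poly f z) \<le> q ^ n * M" for n
  proof -
    have "padic_abs (poly f (X n)) * M \<le> (q ^ (2 ^ n) * D) * D"
      using it(3)[of n] by (simp add: power2_eq_square mult.assoc)
    also have "\<dots> \<le> (q ^ n * M) * M"
      using q D DM by (intro mult_mono power_decreasing) (auto simp: less_imp_le[OF less_exp])
    finally have "padic_abs (poly f (X n)) \<le> q ^ n * M"
      using M by simp
    moreover have "padic_abs (poly f (X n) - poly f z) \<le> q ^ n * M"
      using poly_lipschitz[OF X1[of n] z1, of f, folded M_def]
        mult_left_mono[OF z(2)[of n] less_imp_le[OF M]]
      by (simp add: mult.commute[of M])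
    ultimately show ?thesis
      using padic_abs_diff_le[of "poly f (X n)" "q ^ n * M" "poly f (X n) - poly f z"] by simp
  qed
  then have "padic_abs (poly f z) \<le> 0"
    by (intro LIMSEQ_le_const[OF tendsto_mult_left_zero[OF lim, of M]]) blast
  then have root: "poly f z = 0"
    by simp
  \<comment> \<open>Completeness gave only |X n - z| \<le> q^n. The quadratic rate is recovered by
    passing from X k to an iterate so late that its distance to z is below the desired positive
    bound.\<close>
  have "padic_abs (X k - z) * M \<le> q ^ (2 ^ k) * D" for k
  proof -
    have pos: "0 < q ^ (2 ^ k) * D / M"
      using q D M by simp
    have "eventually (\<lambda>n. q ^ n < q ^ (2 ^ k) * D / M) sequentially"
      using order_tendstoD(2)[OF lim pos] .
    then obtain N where "\<And>n. n \<ge> N \<Longrightarrow> q ^ n < q ^ (2 ^ k) * D / M"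
      by (auto simp: eventually_sequentially)
    \<comment> \<open>The index must be at least N to be near z and at least k for
      \<open>close\<close> to apply.\<close>
    then have "q ^ max N k < q ^ (2 ^ k) * D / M" by simp
    then have "padic_abs (X (max N k) - z) \<le> q ^ (2 ^ k) * D / M"
      using z(2)[of "max N k"] by linarith
    moreover have "padic_abs (X k - X (max N k)) \<le> q ^ (2 ^ k) * D / M"
      using close[of k "max N k"] by (simp add: padic_abs_minus_commute)
    ultimately have "padic_abs (X k - z) \<le> q ^ (2 ^ k) * D / M"
      using padic_abs_triangle_le by blast
    then show ?thesis
      using M by (simp add: pos_le_divide_eq)
  qed
  then show thesis
    using that[of z] z(1) root unfolding X_def D_def M_def q_def zp_roots_def by blast
qed

text \<open>The case k = 0 of the convergence, made strict by 1/p < 1; the strictness yields the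
  contradiction with \<open>root_separation\<close> in the counting argument.\<close>

lemma hensel_root_near:
  fixes x :: "'p::prime_card padic"
  assumes "hensel f x"
  obtains z where "z \<in> zp_roots f"
    and "padic_abs (x - z) * poly_norm f < padic_abs (poly (pderiv f) x)"
proof -
  obtain z where z: "z \<in> zp_roots f" "\<And>k. padic_abs ((newton f ^^ k) x - z) * poly_norm f
      \<le> (1 / real CARD('p)) ^ (2 ^ k) * padic_abs (poly (pderiv f) x)"
    using newton_converges[OF assms] by blast
  have "padic_abs (poly (pderiv f) x) > 0"
    using hensel_pderiv_nonzero[OF assms] by (simp add: order.not_eq_order_implies_strict)
  then have "(1 / real CARD('p)) * padic_abs (poly (pderiv f) x) < 1 * padic_abs (poly (pderiv f) x)"
    using real_CARD_gt_1[where 'p = 'p] by (intro mult_strict_right_mono) auto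
  then show thesis
    using z(2)[of 0] by (intro that[OF z(1)]) simp
qed

text \<open>Existence weakens the rate of \<open>newton_converges\<close> by D \<le> M. Uniqueness
  holds because both candidates are limits of the same iterates.\<close>

lemma newton_unique_root:
  fixes x :: "'p::prime_card padic"
  assumes "hensel f x"
  shows "\<exists>!z. z \<in> zp_roots f \<and>
    (\<forall>k. padic_abs ((newton f ^^ k) x - z) \<le> real CARD('p) powi (- (2 ^ k)))"
proof -
  define q where "q = 1 / real CARD('p)"
  have q: "0 < q" "q < 1"
    using real_CARD_gt_1[where 'p = 'p] by (auto simp: q_def)
  have powi: "real CARD('p) powi (- (2 ^ k)) = q ^ (2 ^ k)" for k
    using power_int_of_nat[of "real CARD('p)" "2 ^ k"]
    by (simp add: q_def power_int_minus power_one_over inverse_eq_divide)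
  define D where "D = padic_abs (poly (pderiv f) x)"
  have D: "D > 0"
    using hensel_pderiv_nonzero[OF assms] by (simp add: D_def order.not_eq_order_implies_strict)
  have DM: "D \<le> poly_norm f"
    using padic_abs_pderiv_le[of x f] assms by (simp add: D_def hensel_def padic_ints_iff)
  obtain z where z: "z \<in> zp_roots f"
    "\<And>k. padic_abs ((newton f ^^ k) x - z) * poly_norm f \<le> q ^ (2 ^ k) * D"
    using newton_converges[OF assms] unfolding q_def D_def by blast
  have "padic_abs ((newton f ^^ k) x - z) \<le> q ^ (2 ^ k)" for k
  proof -
    have "q ^ (2 ^ k) * D \<le> q ^ (2 ^ k) * poly_norm f"
      using q DM by simp
    with z(2)[of k] have "padic_abs ((newton f ^^ k) x - z) * poly_norm f
        \<le> q ^ (2 ^ k) * poly_norm f"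
      by linarith
    then show ?thesis
      using D DM by simp
  qed
  moreover have "y = w"
    if y: "\<And>k. padic_abs ((newton f ^^ k) x - y) \<le> q ^ (2 ^ k)"
      and w: "\<And>k. padic_abs ((newton f ^^ k) x - w) \<le> q ^ (2 ^ k)" for y w
  proof -
    have "padic_abs (y - w) \<le> q ^ k" for k
    proof -
      have "padic_abs (y - w) \<le> q ^ (2 ^ k)"
        using padic_abs_triangle_le[of y "(newton f ^^ k) x" _ w] y[of k] w[of k]
        by (simp add: padic_abs_minus_commute)
      also have "\<dots> \<le> q ^ k"
        using q by (intro power_decreasing) (auto simp: less_imp_le[OF less_exp])
      finally show ?thesis .
    qed
    then have "padic_abs (y - w) \<le> 0"
      using q by (intro LIMSEQ_le_const[OF LIMSEQ_realpow_zero[of q]]) auto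
    then show ?thesis
      by simp
  qed
  ultimately show ?thesis
    using z(1) unfolding powi by (intro ex1I[of _ z]) auto
qed

lemma newton_defined_hensel: "hensel f x \<Longrightarrow> newton_defined f x"
  unfolding newton_defined_def
  by (metis newton_iterates(2) hensel_pderiv_nonzero padic_abs_eq_0_iff)

section \<open>Roots of nearby polynomials\<close>

text \<open>Expanding around x at the root y and dividing by y - x gives g'(x) = - (y - x) r with r
  bounded by the norm.\<close>

lemma root_separation:
  assumes x: "x \<in> zp_roots g" and y: "y \<in> zp_roots g" and ne: "x \<noteq> y"
  shows "padic_abs (poly (pderiv g) x) \<le> padic_abs (x - y) * poly_norm g"
proof -
  have x1: "padic_abs x \<le> 1" and h1: "padic_abs (y - x) \<le> 1"
    using x y by (auto simp: zp_roots_def padic_ints_iff intro: padic_abs_diff_le)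
  obtain r where r: "poly g (x + (y - x)) =
      poly g x + (y - x) * poly (pderiv g) x + (y - x)\<^sup>2 * r" "padic_abs r \<le> poly_norm g"
    by (rule poly_taylor_2[OF x1 h1])
  have "(y - x) * (poly (pderiv g) x + (y - x) * r) = 0"
    using r(1) x y by (simp add: zp_roots_def algebra_simps power2_eq_square)
  then have "poly (pderiv g) x = - ((y - x) * r)"
    using ne by (simp add: add_eq_0_iff2)
  then have "padic_abs (poly (pderiv g) x) = padic_abs (x - y) * padic_abs r"
    by (simp add: padic_abs_mult padic_abs_minus_commute)
  then show ?thesis
    using r(2) by (simp add: mult_left_mono)
qed

lemma finite_zp_roots: "f \<noteq> 0 \<Longrightarrow> finite (zp_roots f)"
  unfolding zp_roots_def by (rule finite_subset[OF _ poly_roots_finite[of f]]) auto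

text \<open>Stated for an ordered pair of polynomials so that it applies in both directions;
  \<open>deriv\<close> lets the separation of roots of g be measured by the derivative of f.\<close>

lemma card_zp_roots_le:
  assumes f: "f \<noteq> 0" and norm: "poly_norm g = poly_norm f"
    and hensel: "\<And>x. x \<in> zp_roots g \<Longrightarrow> hensel f x"
    and deriv: "\<And>x. x \<in> zp_roots g \<Longrightarrow>
      padic_abs (poly (pderiv g) x) = padic_abs (poly (pderiv f) x)"
  shows "card (zp_roots g) \<le> card (zp_roots f)"
proof -
  have "\<forall>x\<in>zp_roots g. \<exists>z. z \<in> zp_roots f \<and>
      padic_abs (x - z) * poly_norm f < padic_abs (poly (pderiv f) x)"
    using hensel_root_near[OF hensel] by metis
  then obtain Z where Z: "\<And>x. x \<in> zp_roots g \<Longrightarrow> Z x \<in> zp_roots f"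
    "\<And>x. x \<in> zp_roots g \<Longrightarrow>
      padic_abs (x - Z x) * poly_norm f < padic_abs (poly (pderiv f) x)"
    by metis
  \<comment> \<open>The derivative of f has the same size at x and at Z x, so roots of g with a
    common image share one separation radius.\<close>
  have DZ: "padic_abs (poly (pderiv f) (Z x)) = padic_abs (poly (pderiv f) x)"
    if "x \<in> zp_roots g" for x
  proof (rule padic_abs_eqI)
    have "padic_abs (poly (pderiv f) (Z x) - poly (pderiv f) x) \<le> poly_norm f * padic_abs (Z x - x)"
      using Z(1)[OF that] that by (intro pderiv_lipschitz) (auto simp: zp_roots_def padic_ints_iff)
    also have "\<dots> < padic_abs (poly (pderiv f) x)"
      using Z(2)[OF that] by (simp add: padic_abs_minus_commute mult.commute)
    finally show "padic_abs (poly (pderiv f) (Z x) - poly (pderiv f) x) < \<dots>" .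
  qed
  have "inj_on Z (zp_roots g)"
  proof (rule inj_onI, rule ccontr)
    fix x y assume x: "x \<in> zp_roots g" and y: "y \<in> zp_roots g" and eq: "Z x = Z y" and ne: "x \<noteq> y"
    have D: "padic_abs (poly (pderiv f) y) = padic_abs (poly (pderiv f) x)"
      using DZ[OF x] DZ[OF y] eq by simp
    have "padic_abs (x - y) \<le> max (padic_abs (x - Z x)) (padic_abs (y - Z y))"
      using padic_abs_diff[of "x - Z x" "y - Z y"] eq by simp
    then have "padic_abs (x - y) * poly_norm f < padic_abs (poly (pderiv f) x)"
      using Z(2)[OF x] Z(2)[OF y] D
        mult_right_mono[of "padic_abs (x - y)" "padic_abs (x - Z x)" "poly_norm f"]
        mult_right_mono[of "padic_abs (x - y)" "padic_abs (y - Z y)" "poly_norm f"]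
      by (fastforce simp: le_max_iff_disj)
    moreover have "padic_abs (poly (pderiv f) x) \<le> padic_abs (x - y) * poly_norm f"
      using root_separation[OF x y ne] deriv[OF x] norm by simp
    ultimately show False by simp
  qed
  then show ?thesis
    using Z(1) finite_zp_roots[OF f] by (intro card_inj_on_le[of Z]) auto
qed

section \<open>The condition number and perturbations\<close>

lemma cond_lower_bound:
  assumes f: "f \<noteq> 0" and K: "cond f = ereal K" and z: "z \<in> padic_ints"
  shows "poly_norm f \<le> K * max (padic_abs (poly f z)) (padic_abs (poly (pderiv f) z))"
proof -
  define m where "m = max (padic_abs (poly f z)) (padic_abs (poly (pderiv f) z))"
  have M: "poly_norm f > 0"
    using f by (simp add: order.not_eq_order_implies_strict)
  have le: "local_cond f z \<le> ereal K"
    unfolding K[symmetric] cond_def by (rule SUP_upper[OF z])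
  \<comment> \<open>If m were 0, the division convention of \<open>ereal\<close> would make
    \<open>local_cond f z\<close> infinite, against the finite bound K.\<close>
  have m: "m > 0"
  proof (rule ccontr)
    assume "\<not> m > 0"
    then have "m = 0"
      unfolding m_def by (meson order_antisym not_less padic_abs_nonneg max.coboundedI1)
    then have "local_cond f z = \<infinity>"
      using M f by (simp add: local_cond_def m_def divide_ereal_def flip: zero_ereal_def)
    then show False
      using le by simp
  qed
  then have "poly_norm f / m \<le> K"
    using le by (simp add: local_cond_def m_def[symmetric])
  then show ?thesis
    using m by (simp add: m_def[symmetric] pos_divide_le_eq)
qed

text \<open>At z = 0 both |f(z)| and |f'(z)| are at most the norm of f, so the local condition
  number there is at least 1.\<close>

lemma cond_ge_1:
  assumes f: "f \<noteq> 0" and K: "cond f = ereal K"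
  shows "K \<ge> 1"
proof -
  define m where "m = max (padic_abs (poly f 0)) (padic_abs (poly (pderiv f) 0))"
  have M: "poly_norm f > 0"
    using f by (simp add: order.not_eq_order_implies_strict)
  have le: "poly_norm f \<le> K * m"
    unfolding m_def by (rule cond_lower_bound[OF assms]) (simp add: padic_ints_iff)
  have m: "0 \<le> m" "m \<le> poly_norm f"
    by (auto simp: m_def le_max_iff_disj padic_abs_poly_le padic_abs_pderiv_le)
  show ?thesis
  proof (rule ccontr)
    assume "\<not> K \<ge> 1"
    moreover have "m > 0"
      using le M m(1) by (cases "m = 0") auto
    ultimately have "K * m < 1 * m"
      by (intro mult_strict_right_mono) auto
    then show False
      using le m(2) by simp
  qed
qed

lemma hensel_of_perturbation:
  assumes f: "f \<noteq> 0" and K: "cond f = ereal K"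
    and close: "K\<^sup>2 * poly_norm (g - f) < poly_norm f"
  shows "poly_norm g = poly_norm f"
    and "x \<in> zp_roots f \<union> zp_roots g \<Longrightarrow>
      padic_abs (poly (pderiv g) x) = padic_abs (poly (pderiv f) x)"
    and "x \<in> zp_roots g \<Longrightarrow> hensel f x"
    and "x \<in> zp_roots f \<Longrightarrow> hensel g x"
proof -
  define M \<delta> where "M = poly_norm f" and "\<delta> = poly_norm (g - f)"
  have M: "M > 0"
    using f by (simp add: M_def order.not_eq_order_implies_strict)
  have K1: "K \<ge> 1"
    by (rule cond_ge_1[OF f K])
  have \<delta>0: "\<delta> \<ge> 0" and close': "K\<^sup>2 * \<delta> < M"
    using close by (simp_all add: \<delta>_def M_def)
  have K\<delta>: "K * \<delta> < M"
  proof -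
    have "K * \<delta> \<le> K\<^sup>2 * \<delta>"
      using K1 \<delta>0 by (intro mult_right_mono) (auto simp: self_le_power)
    then show ?thesis using close' by simp
  qed
  have \<delta>M: "\<delta> < M"
    using K\<delta> mult_right_mono[OF K1 \<delta>0] by simp
  then show norm: "poly_norm g = poly_norm f"
    unfolding \<delta>_def M_def by (rule poly_norm_eqI)
  \<comment> \<open>One argument covers the roots of both polynomials: at each of them one value
    vanishes and the difference of the two is at most \<delta>, so both values are at most
    \<delta>.\<close>
  have key: "padic_abs (poly (pderiv g) x) = padic_abs (poly (pderiv f) x) \<and>
      \<delta> * M < padic_abs (poly (pderiv f) x) ^ 2 \<and>
      padic_abs (poly f x) * M \<le> \<delta> * M \<and> padic_abs (poly g x) * M \<le> \<delta> * M"
    if x: "x \<in> zp_roots f \<union> zp_roots g" for x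
  proof -
    have xi: "x \<in> padic_ints" and x1: "padic_abs x \<le> 1"
      using x by (auto simp: zp_roots_def padic_ints_iff)
    have diff: "padic_abs (poly g x - poly f x) \<le> \<delta>"
      using padic_abs_poly_le[of "g - f" \<delta> x] x1 by (simp add: \<delta>_def)
    then have vals: "padic_abs (poly f x) \<le> \<delta>" "padic_abs (poly g x) \<le> \<delta>"
      using x \<delta>0 by (auto simp: zp_roots_def)
    define D where "D = padic_abs (poly (pderiv f) x)"
    have "M \<le> K * max (padic_abs (poly f x)) D"
      unfolding M_def D_def by (rule cond_lower_bound[OF f K xi])
    \<comment> \<open>Hence |f(x)| cannot account for the lower bound M, and the maximum in the
      condition number must be D.\<close>
    moreover have "K * padic_abs (poly f x) < M"
      by (rule order_le_less_trans[OF mult_left_mono[OF vals(1)] K\<delta>]) (use K1 in simp)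
    ultimately have KD: "M \<le> K * D"
      by (auto simp: max_def split: if_splits)
    have "K * \<delta> < K * D"
      using KD K\<delta> by simp
    then have \<delta>D: "\<delta> < D"
      using K1 by simp
    have "padic_abs (poly (pderiv g) x - poly (pderiv f) x) \<le> \<delta>"
      using padic_abs_pderiv_le[OF x1, of "g - f"] by (simp add: pderiv_diff \<delta>_def)
    then have "padic_abs (poly (pderiv g) x) = D"
      using \<delta>D unfolding D_def by (intro padic_abs_eqI) simp
    moreover have "\<delta> * M < D ^ 2"
    proof -
      \<comment> \<open>The square of the condition number enters here: M^2 \<le> K^2 D^2 turns K^2
        \<delta> < M into \<delta> M < D^2.\<close>
      have "K\<^sup>2 * (\<delta> * M) < M ^ 2"
        using mult_strict_right_mono[OF close' M] by (simp add: power2_eq_square mult.assoc)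
      also have "M ^ 2 \<le> (K * D) ^ 2"
        using KD M by (intro power_mono) auto
      finally have "K\<^sup>2 * (\<delta> * M) < K\<^sup>2 * D\<^sup>2"
        by (simp add: power_mult_distrib)
      then show ?thesis
        using K1 by simp
    qed
    ultimately show ?thesis
      using vals M by (simp add: D_def)
  qed
  then show "x \<in> zp_roots f \<union> zp_roots g \<Longrightarrow>
      padic_abs (poly (pderiv g) x) = padic_abs (poly (pderiv f) x)"
    by blast
  show "hensel f x" if x: "x \<in> zp_roots g"
    using key[of x] x by (auto simp: hensel_def zp_roots_def M_def[symmetric]
        intro: order_le_less_trans simp del: mult_le_cancel_right)
  show "hensel g x" if x: "x \<in> zp_roots f"
    using key[of x] x by (auto simp: hensel_def zp_roots_def norm M_def[symmetric]
        intro: order_le_less_trans simp del: mult_le_cancel_right)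
qed

text \<open>Finiteness of \<open>cond f\<close> is a separate hypothesis because \<infinity> * 0 = 0
  in \<open>ereal\<close>: for g = f with a multiple root in Z_p the inequality would hold by
  convention, although alpha is infinite at that root.\<close>

theorem theorem3p18:
  fixes f g :: "'p::prime_card padic poly" and d :: nat
  assumes "degree f \<le> d" and "degree g \<le> d"
    and "f \<noteq> 0"
    and "cond f \<noteq> \<infinity>"
    and "(cond f)\<^sup>2 * ereal (poly_norm (g - f) / poly_norm f) < 1"
  shows "card (zp_roots f) = card (zp_roots g) \<and>
    (\<forall>\<zeta>'\<in>zp_roots g.
       smale_alpha f \<zeta>' \<le> ereal (1 / real CARD('p)) \<and>
       newton_defined f \<zeta>' \<and>
       (\<exists>!\<zeta>. \<zeta> \<in> zp_roots f \<and>
          (\<forall>k. padic_abs ((newton f ^^ k) \<zeta>' - \<zeta>) \<le> real CARD('p) powi (- (2 ^ k))))) \<and>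
    (\<forall>\<zeta>\<in>zp_roots f.
       smale_alpha g \<zeta> \<le> ereal (1 / real CARD('p)) \<and>
       newton_defined g \<zeta> \<and>
       (\<exists>!\<zeta>'. \<zeta>' \<in> zp_roots g \<and>
          (\<forall>k. padic_abs ((newton g ^^ k) \<zeta> - \<zeta>') \<le> real CARD('p) powi (- (2 ^ k)))))"
proof -
  have M: "poly_norm f > 0"
    using assms(3) by (simp add: order.not_eq_order_implies_strict)
  \<comment> \<open>Nonnegativity excludes -\<infinity>, so a finite \<open>cond f\<close> is a real
    number K.\<close>
  have "0 \<le> local_cond f 0"
    unfolding local_cond_def by (intro zero_le_divide_ereal) (simp_all add: le_max_iff_disj)
  also have "\<dots> \<le> cond f"
    unfolding cond_def by (rule SUP_upper) (simp add: padic_ints_iff)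
  finally obtain K where K: "cond f = ereal K"
    using assms(4) by (cases "cond f") auto
  have "K\<^sup>2 * poly_norm (g - f) < poly_norm f"
    using assms(5) M by (simp add: K field_simps)
  note pert = hensel_of_perturbation[OF assms(3) K this]
  have "g \<noteq> 0"
    using pert(1) assms(3) by (metis poly_norm_eq_0_iff)
  have "card (zp_roots f) = card (zp_roots g)"
    \<comment> \<open>The second application exchanges f and g: equality of the derivatives and
      Hensel's condition are available at the roots of both.\<close>
    using card_zp_roots_le[OF assms(3) pert(1)] card_zp_roots_le[OF \<open>g \<noteq> 0\<close> pert(1)[symmetric]] pert
    by (intro antisym) auto
  then show ?thesis
    by (intro conjI ballI smale_alpha_le newton_defined_hensel newton_unique_root pert(3,4))
qed

end
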